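(* Let $L=(\ell_{ij})\in\mathbb{R}^{N\times N}$ be a Laplacian matrix and let $k\in\{1,\dots,N\}$ be an index whose neighbor set $\mathcal{N}_k=\{i:\ell_{ki}\neq 0,\ i\neq k\}$ is nonempty. Then, for every outcome of the random choices, the edges sampled by the procedure SampleClique$(L,k)$ (described in the context) form a spanning tree of the clique (complete graph) on the vertex set $\mathcal{N}_k$.
   Context: A matrix $L\in\mathbb{R}^{N\times N}$ is a Laplacian matrix if $L=L^\top$, $\sum_{j=1}^N \ell_{ij}=0$ for all $i$, and $\ell_{ij}\le 0$ for $i\ne j$. Write $b_{ij}=e_i-e_j$, where $e_1,\dots,e_N$ is the standard basis of $\mathbb{R}^N$. Procedure SampleClique$(L,k)$ (input: Laplacian matrix $L$ and index $k$; output: $C\in\mathbb{R}^{N\times N}$, the graph Laplacian of the sampled weighted edges): 1. Set $C=0$. Let $\mathcal{N}$ be the set $\mathcal{N}_k$ sorted in ascending order of $|\ell_{ki}|$, $i\in\mathcal{N}_k$. Set $S=\ell_{kk}$ (which equals $-\sum_{i\in\mathcal{N}_k}\ell_{ki}$). 2. While $|\mathcal{N}|>1$: let $i$ be the first element of $\mathcal{N}$; remove $i$ from $\mathcal{N}$; set $S\leftarrow S+\ell_{ki}$ (so that now $S=-\sum_{j\in\mathcal{N}}\ell_{kj}$); sample a random $j\in\mathcal{N}$, where $j$ is chosen with probability $|\ell_{kj}|/S$; set $C\leftarrow C-\frac{S\,\ell_{ki}}{\ell_{kk}}\,b_{ij}b_{ij}^\top$, i.e. the edge $(i,j)$ is sampled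 and given weight $S|\ell_{ki}|/\ell_{kk}$. 3. Return $C$. *)

theory Defs
  imports "HOL-Analysis.Analysis" "HOL-Probability.Probability_Mass_Function"
begin

section \<open>Undirected graphs\<close>

text \<open>
  A simple graph is given by its vertex set \<open>V\<close> and its edge set \<open>E\<close>, a set of
  two-element subsets of \<open>V\<close>.  (The notions of tree and spanning tree in the AFP entry
  Graph_Theory are about directed cycles, so they do not express undirected acyclicity.)
\<close>

definition clique_edges :: "'a set \<Rightarrow> 'a set set" where
  "clique_edges V = {{u, v} | u v. u \<in> V \<and> v \<in> V \<and> u \<noteq> v}"

definition walk :: "'a set \<Rightarrow> 'a set set \<Rightarrow> 'a list \<Rightarrow> bool" where
  "walk V E p \<longleftrightarrow> p \<noteq> [] \<and> set p \<subseteq> V \<and> successively (\<lambda>u v. {u, v} \<in> E) p"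

definition graph_connected :: "'a set \<Rightarrow> 'a set set \<Rightarrow> bool" where
  "graph_connected V E \<longleftrightarrow> V \<noteq> {} \<and>
     (\<forall>u\<in>V. \<forall>v\<in>V. \<exists>p. walk V E p \<and> hd p = u \<and> last p = v)"

text \<open>A cycle is listed without repeating its initial vertex at the end.\<close>

definition graph_cycle :: "'a set \<Rightarrow> 'a set set \<Rightarrow> 'a list \<Rightarrow> bool" where
  "graph_cycle V E p \<longleftrightarrow> walk V E p \<and> distinct p \<and> length p \<ge> 3 \<and> {last p, hd p} \<in> E"

definition is_tree :: "'a set \<Rightarrow> 'a set set \<Rightarrow> bool" where
  "is_tree V E \<longleftrightarrow> graph_connected V E \<and> (\<nexists>p. graph_cycle V E p)"

text \<open>\<open>F\<close> is the edge set of a spanning tree of the graph \<open>(V, E)\<close>.\<close>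

definition is_spanning_tree :: "'a set \<Rightarrow> 'a set set \<Rightarrow> 'a set set \<Rightarrow> bool" where
  "is_spanning_tree V E F \<longleftrightarrow> F \<subseteq> E \<and> is_tree V F"

section \<open>Laplacian matrices and clique sampling\<close>

definition laplacian :: "real^'n^'n \<Rightarrow> bool" where
  "laplacian L \<longleftrightarrow> L = transpose L \<and> (\<forall>i. (\<Sum>j\<in>UNIV. L $ i $ j) = 0) \<and>
     (\<forall>i j. i \<noteq> j \<longrightarrow> L $ i $ j \<le> 0)"

definition neighbors :: "real^'n^'n \<Rightarrow> 'n \<Rightarrow> 'n set" where
  "neighbors L k = {i. L $ k $ i \<noteq> 0 \<and> i \<noteq> k}"

text \<open>
  \<open>xs\<close> lists the neighbors of \<open>k\<close> in ascending order of \<open>\<bar>L $ k $ i\<bar>\<close>.  Ties may be broken in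
  any way, so there can be several such lists.
\<close>

definition ascending_neighbors :: "real^'n^'n \<Rightarrow> 'n \<Rightarrow> 'n list \<Rightarrow> bool" where
  "ascending_neighbors L k xs \<longleftrightarrow> set xs = neighbors L k \<and> distinct xs \<and>
     sorted (map (\<lambda>i. \<bar>L $ k $ i\<bar>) xs)"

definition edge_vec :: "'n \<Rightarrow> 'n \<Rightarrow> real^'n" where
  "edge_vec i j = axis i 1 - axis j 1"

definition edge_laplacian :: "'n \<Rightarrow> 'n \<Rightarrow> real^'n^'n" where
  "edge_laplacian i j =
     (columnvector (edge_vec i j) :: real^1^'n) ** rowvector (edge_vec i j)"

text \<open>
  The weights form a probability distribution when \<open>S\<close> is positive and equals the sum of the
  \<open>\<bar>L $ k $ j\<bar>\<close> over the list (see \<open>pmf_sample_neighbor\<close>).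
\<close>

definition sample_neighbor :: "real^'n^'n \<Rightarrow> 'n \<Rightarrow> 'n list \<Rightarrow> real \<Rightarrow> 'n pmf" where
  "sample_neighbor L k xs S = embed_pmf (\<lambda>j. if j \<in> set xs then \<bar>L $ k $ j\<bar> / S else 0)"

lemma pmf_sample_neighbor:
  fixes L :: "real^'n^'n"
  assumes "S > 0" and "S = (\<Sum>j\<in>set xs. \<bar>L $ k $ j\<bar>)"
  shows "pmf (sample_neighbor L k xs S) j = (if j \<in> set xs then \<bar>L $ k $ j\<bar> / S else 0)"
proof -
  let ?f = "\<lambda>j. if j \<in> set xs then \<bar>L $ k $ j\<bar> / S else 0"
  have "(\<Sum>j\<in>UNIV. ?f j) = (\<Sum>j\<in>set xs. \<bar>L $ k $ j\<bar> / S)"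
    by (simp add: sum.If_cases)
  also have "\<dots> = 1"
    using assms by (simp flip: sum_divide_distrib)
  finally have *: "(\<Sum>j\<in>UNIV. ?f j) = 1" .
  have nonneg: "?f j \<ge> 0" for j
    using assms(1) by simp
  have "(\<integral>\<^sup>+ j. ennreal (?f j) \<partial>count_space UNIV) = (\<Sum>j\<in>UNIV. ennreal (?f j))"
    by (simp add: nn_integral_count_space_finite)
  also have "\<dots> = ennreal (\<Sum>j\<in>UNIV. ?f j)"
    by (rule sum_ennreal) (rule nonneg)
  finally show ?thesis
    unfolding sample_neighbor_def using nonneg * by (subst pmf_embed_pmf) auto
qed

text \<open>
  The loop state consists of the remaining neighbors (in order), the scalar \<open>S\<close>, the matrix \<open>C\<close>
  and the set \<open>E\<close> of edges sampled so far.  The set \<open>E\<close> only records the choices made; the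
  procedure itself returns \<open>C\<close>.
\<close>

primrec sample_clique_loop ::
  "real^'n^'n \<Rightarrow> 'n \<Rightarrow> 'n list \<Rightarrow> real \<Rightarrow> real^'n^'n \<Rightarrow> 'n set set \<Rightarrow> ((real^'n^'n) \<times> 'n set set) pmf"
where
  "sample_clique_loop L k [] S C E = return_pmf (C, E)"
| "sample_clique_loop L k (i # xs) S C E =
     (if xs = [] then return_pmf (C, E)
      else let S' = S + L $ k $ i in
        bind_pmf (sample_neighbor L k xs S') (\<lambda>j.
          sample_clique_loop L k xs S'
            (C - (S' * L $ k $ i / L $ k $ k) *\<^sub>R edge_laplacian i j) (insert {i, j} E)))"

definition sample_clique ::
  "real^'n^'n \<Rightarrow> 'n \<Rightarrow> 'n list \<Rightarrow> ((real^'n^'n) \<times> 'n set set) pmf" where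
  "sample_clique L k xs = sample_clique_loop L k xs (L $ k $ k) 0 {}"

end

theory Submission
  imports Defs
begin

text \<open>
  Read the loop backwards.  When the neighbor \<open>i\<close> is removed from the list, it is joined to one
  vertex \<open>j\<close> among the neighbors still to come, and no later edge meets \<open>i\<close>.  So the edges sampled
  from a list \<open>i # xs\<close> are the edges sampled from \<open>xs\<close> together with a pendant edge at the new vertex
  \<open>i\<close>.  The last neighbor alone is a tree without edges, and attaching a leaf turns a spanning
  tree of the clique on \<open>V\<close> into one of the clique on \<open>insert i V\<close>
  (\<open>is_spanning_tree_insert_leaf\<close>); induction over the list gives the theorem.

  What has to be checked about the weights is that \<open>j\<close> really comes from the remaining list.  The
  sampling distribution is only specified when its normalizer is positive and is the total weight
  of the remaining neighbors.  Vanishing row sums give this for the initial value \<open>L $ k $ k\<close>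
  (\<open>laplacian_diagonal_eq_sum_neighbors\<close>), and each round subtracts exactly the weight of the
  removed neighbor.
\<close>

section \<open>Attaching a leaf to a spanning tree of a clique\<close>

lemma walk_mono:
  assumes "walk V F p" and "V \<subseteq> W" and "F \<subseteq> G"
  shows "walk W G p"
  using assms successively_mono[of "\<lambda>u v. {u, v} \<in> F" p "\<lambda>u v. {u, v} \<in> G"]
  unfolding walk_def by blast

lemma walk_Cons:
  assumes "walk V F p" and "i \<in> V" and "{i, hd p} \<in> F"
  shows "walk V F (i # p)"
  using assms unfolding walk_def by (auto simp: successively_Cons)

lemma walk_snoc:
  assumes "walk V F p" and "i \<in> V" and "{last p, i} \<in> F"
  shows "walk V F (p @ [i])"
  using assms unfolding walk_def by (auto simp: successively_append_iff)

lemma graph_connected_insert_leaf: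
  assumes conn: "graph_connected V F" and "j \<in> V"
  shows "graph_connected (insert i V) (insert {i, j} F)"
  unfolding graph_connected_def
proof (intro conjI ballI)
  fix u v assume uv: "u \<in> insert i V" "v \<in> insert i V"
  have old: "\<exists>p. walk (insert i V) (insert {i, j} F) p \<and> hd p = u \<and> last p = v"
    if "u \<in> V" "v \<in> V" for u v
    using conn that unfolding graph_connected_def by (meson walk_mono subset_insertI)
  consider "u \<in> V" "v \<in> V" | "u = i" "v = i" | "u = i" "v \<in> V" | "u \<in> V" "v = i"
    using uv by blast
  then show "\<exists>p. walk (insert i V) (insert {i, j} F) p \<and> hd p = u \<and> last p = v"
  proof cases
    case 1
    then show ?thesis by (rule old)
  next
    case 2
    then show ?thesis by (intro exI[of _ "[i]"]) (simp add: walk_def)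
  next
    case 3
    with old[OF \<open>j \<in> V\<close>] obtain p
      where "walk (insert i V) (insert {i, j} F) p" "hd p = j" "last p = v" by blast
    with 3 show ?thesis
      by (intro exI[of _ "i # p"]) (auto intro: walk_Cons simp: walk_def[of _ _ p])
  next
    case 4
    with old[OF _ \<open>j \<in> V\<close>] obtain p
      where "walk (insert i V) (insert {i, j} F) p" "hd p = u" "last p = j" by blast
    with 4 show ?thesis
      by (intro exI[of _ "p @ [i]"])
        (auto intro!: walk_snoc simp: walk_def[of _ _ p] insert_commute)
  qed
qed simp

lemma graph_cycle_rotate:
  assumes "graph_cycle V F (us @ i # vs)"
  shows "graph_cycle V F (i # vs @ us)"
proof (cases "us = []")
  case True
  with assms show ?thesis by simp
next
  case False
  with assms show ?thesis
    unfolding graph_cycle_def walk_def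
    by (cases "vs = []") (simp_all add: successively_append_iff successively_Cons insert_commute Int_commute)
qed

text \<open>
  A vertex on a cycle has two distinct neighbors there, one on each side.  The new vertex \<open>i\<close> has
  only the neighbor \<open>j\<close>, so a cycle must avoid it and already lies in the old graph.
\<close>

lemma no_graph_cycle_insert_leaf:
  assumes acyclic: "\<nexists>p. graph_cycle V F p" and "i \<notin> \<Union>F" and "i \<noteq> j"
  shows "\<nexists>p. graph_cycle (insert i V) (insert {i, j} F) p"
proof
  assume "\<exists>p. graph_cycle (insert i V) (insert {i, j} F) p"
  then obtain p where p: "graph_cycle (insert i V) (insert {i, j} F) p" ..
  show False
  proof (cases "i \<in> set p")
    case True
    then obtain us vs where "p = us @ i # vs" by (meson split_list)
    with p obtain q where q: "graph_cycle (insert i V) (insert {i, j} F) (i # q)"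
      using graph_cycle_rotate by metis
    have only: "x = j" if "{i, x} \<in> insert {i, j} F" for x
      using that \<open>i \<notin> \<Union>F\<close> \<open>i \<noteq> j\<close> by (auto simp: doubleton_eq_iff)
    from q have "length q \<ge> 2" "distinct q" by (auto simp: graph_cycle_def)
    then have "hd q \<noteq> last q"
      by (cases q) auto
    moreover have "{i, hd q} \<in> insert {i, j} F"
      using q \<open>length q \<ge> 2\<close> unfolding graph_cycle_def walk_def successively_Cons by auto
    moreover have "{last q, i} \<in> insert {i, j} F"
      using q \<open>length q \<ge> 2\<close> unfolding graph_cycle_def by (cases "q = []") auto
    ultimately show False
      using only by (metis insert_commute)
  next
    case False
    have "graph_cycle V F p"
      unfolding graph_cycle_def walk_def
    proof (intro conjI)
      show "p \<noteq> []" "distinct p" "3 \<le> length p" "set p \<subseteq> V"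
        using p False by (auto simp: graph_cycle_def walk_def)
      have "successively (\<lambda>u v. {u, v} \<in> insert {i, j} F) p"
        using p by (simp add: graph_cycle_def walk_def)
      then show "successively (\<lambda>u v. {u, v} \<in> F) p"
        by (rule successively_mono) (use False in \<open>auto simp: doubleton_eq_iff\<close>)
      have "last p \<noteq> i" "hd p \<noteq> i"
        using False \<open>p \<noteq> []\<close> hd_in_set last_in_set by blast+
      then show "{last p, hd p} \<in> F"
        using p by (auto simp: graph_cycle_def doubleton_eq_iff)
    qed
    with acyclic show False by blast
  qed
qed

lemma is_spanning_tree_insert_leaf:
  assumes "is_spanning_tree V (clique_edges V) F" and "i \<notin> V" and "j \<in> V"
  shows "is_spanning_tree (insert i V) (clique_edges (insert i V)) (insert {i, j} F)"
proof -
  from assms(1) have F: "F \<subseteq> clique_edges V" and conn: "graph_connected V F"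
    and acyclic: "\<nexists>p. graph_cycle V F p"
    by (simp_all add: is_spanning_tree_def is_tree_def)
  have "i \<notin> \<Union>F"
    using F \<open>i \<notin> V\<close> by (auto simp: clique_edges_def)
  moreover have "i \<noteq> j"
    using assms(2,3) by blast
  moreover have "{i, j} \<in> clique_edges (insert i V)"
    unfolding clique_edges_def using \<open>j \<in> V\<close> \<open>i \<noteq> j\<close> by blast
  moreover have "F \<subseteq> clique_edges (insert i V)"
    using F unfolding clique_edges_def by blast
  ultimately show ?thesis
    unfolding is_spanning_tree_def is_tree_def
    using no_graph_cycle_insert_leaf[OF acyclic] graph_connected_insert_leaf[OF conn \<open>j \<in> V\<close>]
    by simp
qed

lemma is_spanning_tree_singleton: "is_spanning_tree {v} (clique_edges {v}) {}"
proof -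
  have "walk {v} {} [v]"
    by (simp add: walk_def)
  then have "graph_connected {v} {}"
    unfolding graph_connected_def by force
  then show ?thesis
    by (auto simp: is_spanning_tree_def is_tree_def graph_cycle_def)
qed

section \<open>The edges sampled by the loop\<close>

lemma set_pmf_sample_neighbor:
  fixes L :: "real^'n^'n"
  assumes "S > 0" and "S = (\<Sum>j\<in>set xs. \<bar>L $ k $ j\<bar>)"
  shows "set_pmf (sample_neighbor L k xs S) \<subseteq> set xs"
  using pmf_sample_neighbor[OF assms] by (auto simp: set_pmf_iff split: if_splits)

text \<open>
  The accumulated set \<open>E\<close> is arbitrary, because the induction passes to a tail of the list after
  edges have been recorded; only the new edges \<open>F\<close> depend on the list.
\<close>

lemma sample_clique_loop_spanning_tree:
  fixes L :: "real^'n^'n"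
  assumes "(C', E') \<in> set_pmf (sample_clique_loop L k xs S C E)"
    and "xs \<noteq> []" and "distinct xs" and "\<forall>j\<in>set xs. L $ k $ j < 0"
    and "S = (\<Sum>j\<in>set xs. \<bar>L $ k $ j\<bar>)"
  shows "\<exists>F. E' = E \<union> F \<and> is_spanning_tree (set xs) (clique_edges (set xs)) F"
  using assms
proof (induction xs arbitrary: S C E)
  case Nil
  then show ?case by simp
next
  case (Cons i xs)
  show ?case
  proof (cases "xs = []")
    case True
    with Cons.prems(1) show ?thesis
      using is_spanning_tree_singleton[of i] by auto
  next
    case False
    define S' where "S' = S + L $ k $ i"
    have S': "S' = (\<Sum>j\<in>set xs. \<bar>L $ k $ j\<bar>)"
      using Cons.prems(3-5) by (simp add: S'_def)
    have "S' > 0"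
      unfolding S' using False Cons.prems(4) by (intro sum_pos) auto
    obtain j where j: "j \<in> set_pmf (sample_neighbor L k xs S')"
      and loop: "(C', E') \<in> set_pmf (sample_clique_loop L k xs S'
        (C - (S' * L $ k $ i / L $ k $ k) *\<^sub>R edge_laplacian i j) (insert {i, j} E))"
      using Cons.prems(1) False by (auto simp: Let_def S'_def)
    have "j \<in> set xs"
      using j set_pmf_sample_neighbor[OF \<open>S' > 0\<close> S'] by blast
    obtain F where E': "E' = insert {i, j} E \<union> F"
      and F: "is_spanning_tree (set xs) (clique_edges (set xs)) F"
      using Cons.IH[OF loop False _ _ S'] Cons.prems(3,4) by auto
    have "is_spanning_tree (set (i # xs)) (clique_edges (set (i # xs))) (insert {i, j} F)"
      using is_spanning_tree_insert_leaf[OF F _ \<open>j \<in> set xs\<close>, of i] Cons.prems(3) by simp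
    moreover have "E' = E \<union> insert {i, j} F"
      using E' by blast
    ultimately show ?thesis by blast
  qed
qed

section \<open>Sampling from a Laplacian matrix\<close>

lemma laplacian_neighbor_neg:
  assumes "laplacian L" and "j \<in> neighbors L k"
  shows "L $ k $ j < 0"
  using assms by (force simp: laplacian_def neighbors_def less_le)

lemma laplacian_diagonal_eq_sum_neighbors:
  fixes L :: "real^'n^'n"
  assumes "laplacian L"
  shows "L $ k $ k = (\<Sum>j\<in>neighbors L k. \<bar>L $ k $ j\<bar>)"
proof -
  have "0 = (\<Sum>j\<in>UNIV. L $ k $ j)"
    using assms by (simp add: laplacian_def)
  also have "\<dots> = (\<Sum>j\<in>insert k (neighbors L k). L $ k $ j)"
    by (rule sum.mono_neutral_right) (auto simp: neighbors_def)
  also have "\<dots> = L $ k $ k + (\<Sum>j\<in>neighbors L k. L $ k $ j)"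
    by (rule sum.insert) (auto simp: neighbors_def)
  also have "(\<Sum>j\<in>neighbors L k. L $ k $ j) = - (\<Sum>j\<in>neighbors L k. \<bar>L $ k $ j\<bar>)"
    unfolding sum_negf[symmetric]
    by (rule sum.cong) (auto dest: laplacian_neighbor_neg[OF assms])
  finally show ?thesis by simp
qed

theorem theorem2p7:
  fixes L :: "real^'n^'n" and k :: 'n and xs :: "'n list"
    and C :: "real^'n^'n" and E :: "'n set set"
  assumes "laplacian L"
    and "neighbors L k \<noteq> {}"
    and "ascending_neighbors L k xs"
    and "(C, E) \<in> set_pmf (sample_clique L k xs)"
  shows "is_spanning_tree (neighbors L k) (clique_edges (neighbors L k)) E"
proof -
  have xs: "set xs = neighbors L k" "distinct xs"
    using assms(3) by (auto simp: ascending_neighbors_def)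
  have "\<exists>F. E = {} \<union> F \<and> is_spanning_tree (set xs) (clique_edges (set xs)) F"
  proof (rule sample_clique_loop_spanning_tree)
    show "(C, E) \<in> set_pmf (sample_clique_loop L k xs (L $ k $ k) 0 {})"
      using assms(4) by (simp add: sample_clique_def)
    show "xs \<noteq> []" "distinct xs"
      using xs assms(2) by auto
    show "\<forall>j\<in>set xs. L $ k $ j < 0"
      using xs laplacian_neighbor_neg[OF assms(1)] by simp
    show "L $ k $ k = (\<Sum>j\<in>set xs. \<bar>L $ k $ j\<bar>)"
      using xs laplacian_diagonal_eq_sum_neighbors[OF assms(1)] by simp
  qed
  then show ?thesis using xs by simp
qed

end
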